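(* Let $\aleph_0 < \kappa < \lambda = \lambda^\kappa$, $2^\kappa \leq \lambda$, with $\kappa$ measurable. Let $E$ be a uniform $\aleph_1$-complete ultrafilter on $\kappa$, let $D_1$ be a regular $\lambda^+$-good ultrafilter on $\lambda$, and let $D = D_1\times E$ be the product ultrafilter on $\lambda\times\kappa$. Then $\operatorname{lcf}(\aleph_0,D)=\operatorname{lcf}(\aleph_0,D_1)\geq\lambda^+$. Thus a regular ultrafilter on an index set of cardinality $\lambda > \kappa$ may have lower cofinality of $\aleph_0$ at least $\lambda^+$ while failing to $(2^\kappa)^+$-saturate the random graph: $D$ is regular and for every model $M$ of the theory of the random graph, $M^{\lambda\times\kappa}/D$ is not $(2^\kappa)^+$-saturated.
   Context: A filter $D$ on a set $I$ with $|I|=\lambda$ is regular if there are $X_i \in D$ ($i<\lambda$) such that each $t\in I$ belongs to only finitely many $X_i$. An ultrafilter on an infinite set $I$ is uniform if all its members have cardinality $|I|$. A filter $D$ on $I$ is $\mu^+$-good if every $f:[\mu]^{<\aleph_0}\to D$ has a multiplicative refinement, i.e. there is $g:[\mu]^{<\aleph_0}\to D$ with $g(u)\subseteq f(u)$ and $g(u)\cap g(v)=g(u\cup v)$ for all finite $u,v\subseteq\mu$. For an ultrafilter $D$ on $I$, $\operatorname{lcf}(\aleph_0,D)$ (the lower cofinality of $\aleph_0$) is the cofinality, in the reversed order, of the set of elements of $(\mathbb{N},<)^I/D$ lying above the diagonal embedding of $\mathbb{N}$. If $D_1,D_2$ are ultrafilters on $I_1,I_2$, the product ultrafilter $D_1\times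 D_2$ on $I_1\times I_2$ is defined by $X\in D_1\times D_2 \iff \{t\in I_2 : \{s\in I_1 : (s,t)\in X\}\in D_1\}\in D_2$. An uncountable cardinal $\kappa$ is measurable if there is a $\kappa$-complete nonprincipal ultrafilter on $\kappa$. The theory of the random graph is the complete theory of the Rado graph in the language with equality and one binary relation. *)

theory Defs
  imports Main
begin

unbundle cardinal_syntax

text \<open>
  Cardinals are the cardinal orders of the library, up to \<open>=o\<close>. A filter on an index
  set is a filter on a type, so that its index set is the universe of that type.
\<close>

section \<open>Filters and ultrafilters\<close>

definition members :: "'i filter \<Rightarrow> 'i set set" where
  "members D = {X. eventually (\<lambda>t. t \<in> X) D}"

definition ultrafilter :: "'i filter \<Rightarrow> bool" where
  "ultrafilter D \<longleftrightarrow> D \<noteq> bot \<and> (\<forall>X. X \<in> members D \<or> - X \<in> members D)"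

definition nonprincipal :: "'i filter \<Rightarrow> bool" where
  "nonprincipal D \<longleftrightarrow> (\<forall>t. {t} \<notin> members D)"

definition uniform :: "'i filter \<Rightarrow> bool" where
  "uniform D \<longleftrightarrow> (\<forall>X \<in> members D. |X| =o |UNIV :: 'i set| )"

definition complete_filter :: "'r rel \<Rightarrow> 'i filter \<Rightarrow> bool" where
  "complete_filter r D \<longleftrightarrow> (\<forall>\<X>. \<X> \<subseteq> members D \<and> |\<X>| <o r \<longrightarrow> \<Inter>\<X> \<in> members D)"

text \<open>The family is indexed by the index type itself, which has the required cardinality.\<close>

definition regular_filter :: "'i filter \<Rightarrow> bool" where
  "regular_filter D \<longleftrightarrow>
     (\<exists>X :: 'i \<Rightarrow> 'i set. (\<forall>i. X i \<in> members D) \<and> (\<forall>t. finite {i. t \<in> X i}))"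

text \<open>\<open>succ_good M D\<close> says that \<open>D\<close> is \<open>\<mu>\<^sup>+\<close>-good for \<open>\<mu> = |M|\<close>.\<close>

definition succ_good :: "'m set \<Rightarrow> 'i filter \<Rightarrow> bool" where
  "succ_good M D \<longleftrightarrow>
     (\<forall>f. (\<forall>u \<in> Fpow M. f u \<in> members D) \<longrightarrow>
       (\<exists>g. (\<forall>u \<in> Fpow M. g u \<in> members D \<and> g u \<subseteq> f u) \<and>
            (\<forall>u \<in> Fpow M. \<forall>v \<in> Fpow M. g u \<inter> g v = g (u \<union> v))))"

definition measurable_cardinal :: "'k rel \<Rightarrow> bool" where
  "measurable_cardinal r \<longleftrightarrow> Card_order r \<and> natLeq <o r \<and>
     (\<exists>U :: 'k filter. ultrafilter U \<and> Field r \<in> members U \<and>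
        nonprincipal U \<and> complete_filter r U)"

text \<open>This differs from the library's \<open>\<times>\<^sub>F\<close>; see \<open>eventually_product_ultrafilter\<close>.\<close>

definition product_ultrafilter :: "'i filter \<Rightarrow> 'j filter \<Rightarrow> ('i \<times> 'j) filter" where
  "product_ultrafilter D1 D2 =
     Abs_filter (\<lambda>P. eventually (\<lambda>t. eventually (\<lambda>s. P (s, t)) D1) D2)"

lemma eventually_product_ultrafilter:
  "eventually P (product_ultrafilter D1 D2) \<longleftrightarrow>
     eventually (\<lambda>t. eventually (\<lambda>s. P (s, t)) D1) D2"
  unfolding product_ultrafilter_def
proof (rule eventually_Abs_filter, rule is_filter.intro, goal_cases)
  case 1
  show ?case by simp
next
  case (2 P Q)
  then show ?case by (simp add: eventually_conj_iff)
next
  case (3 P Q)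
  show ?case
    by (rule eventually_mono[OF 3(2)]) (auto elim: eventually_mono simp: 3(1))
qed

lemma members_product_ultrafilter:
  "X \<in> members (product_ultrafilter D1 D2) \<longleftrightarrow>
     {t. {s. (s, t) \<in> X} \<in> members D1} \<in> members D2"
  by (simp add: members_def eventually_product_ultrafilter)

section \<open>Structures with one binary relation\<close>

datatype 'a struct = Struct (univ: "'a set") (edge: "'a \<Rightarrow> 'a \<Rightarrow> bool")

definition up_eq :: "'i filter \<Rightarrow> 'a set \<Rightarrow> ('i \<Rightarrow> 'a) rel" where
  "up_eq D A = {(f, g). range f \<subseteq> A \<and> range g \<subseteq> A \<and> eventually (\<lambda>i. f i = g i) D}"

definition ultrapower :: "'i filter \<Rightarrow> 'a struct \<Rightarrow> ('i \<Rightarrow> 'a) set struct" where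
  "ultrapower D M = Struct
     ({f. range f \<subseteq> univ M} // up_eq D (univ M))
     (\<lambda>X Y. \<exists>f \<in> X. \<exists>g \<in> Y. eventually (\<lambda>i. edge M (f i) (g i)) D)"

definition diag :: "'i filter \<Rightarrow> 'a struct \<Rightarrow> 'a \<Rightarrow> ('i \<Rightarrow> 'a) set" where
  "diag D M a = up_eq D (univ M) `` {\<lambda>_. a}"

section \<open>The lower cofinality of \<open>\<aleph>\<^sub>0\<close>\<close>

definition cofinal_subset :: "'a set \<Rightarrow> 'a rel \<Rightarrow> bool" where
  "cofinal_subset B r \<longleftrightarrow> B \<subseteq> Field r \<and> (\<forall>a \<in> Field r. \<exists>b \<in> B. (a, b) \<in> r)"

text \<open>Intended for reflexive \<open>r\<close>; the choice is over a nonempty set by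
  \<open>ex_minimal_cofinal_subset\<close>, and all choices have the same cardinality.\<close>

definition cofinality :: "'a rel \<Rightarrow> 'a rel" where
  "cofinality r =
     |SOME B. cofinal_subset B r \<and> (\<forall>B'. cofinal_subset B' r \<longrightarrow> |B| \<le>o |B'| )|"

lemma ex_minimal_cofinal_subset:
  assumes "\<And>a. a \<in> Field r \<Longrightarrow> (a, a) \<in> r"
  shows "\<exists>B. cofinal_subset B r \<and> (\<forall>B'. cofinal_subset B' r \<longrightarrow> |B| \<le>o |B'| )"
proof -
  let ?R = "card_of ` {B. cofinal_subset B r}"
  have "cofinal_subset (Field r) r"
    using assms by (auto simp: cofinal_subset_def)
  then have "?R \<noteq> {}" by blast
  moreover have "\<forall>s \<in> ?R. Well_order s" by (auto simp: card_of_Well_order)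
  ultimately have "\<exists>s \<in> ?R. \<forall>s' \<in> ?R. s \<le>o s'"
    by (rule exists_minim_Well_order)
  then show ?thesis by simp
qed

definition nat_struct :: "nat struct" where
  "nat_struct = Struct UNIV (<)"

definition above_diag :: "'i filter \<Rightarrow> ('i \<Rightarrow> nat) set set" where
  "above_diag D = {X \<in> univ (ultrapower D nat_struct).
     \<forall>n. edge (ultrapower D nat_struct) (diag D nat_struct n) X}"

text \<open>The order is reversed: \<open>(X, Y)\<close> is in the relation iff \<open>Y \<le> X\<close> in the ultrapower.\<close>

definition lcf :: "'i filter \<Rightarrow> ('i \<Rightarrow> nat) set rel" where
  "lcf D = cofinality {(X, Y). X \<in> above_diag D \<and> Y \<in> above_diag D \<and>
     (Y = X \<or> edge (ultrapower D nat_struct) Y X)}"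

section \<open>First-order logic with equality and one binary relation symbol\<close>

datatype form =
    Eq nat nat
  | Rel nat nat
  | Neg form
  | Conj form form
  | Ex nat form

primrec fv :: "form \<Rightarrow> nat set" where
  "fv (Eq x y) = {x, y}"
| "fv (Rel x y) = {x, y}"
| "fv (Neg \<phi>) = fv \<phi>"
| "fv (Conj \<phi> \<psi>) = fv \<phi> \<union> fv \<psi>"
| "fv (Ex x \<phi>) = fv \<phi> - {x}"

primrec sat :: "'a struct \<Rightarrow> (nat \<Rightarrow> 'a) \<Rightarrow> form \<Rightarrow> bool" where
  "sat M e (Eq x y) \<longleftrightarrow> e x = e y"
| "sat M e (Rel x y) \<longleftrightarrow> edge M (e x) (e y)"
| "sat M e (Neg \<phi>) \<longleftrightarrow> \<not> sat M e \<phi>"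
| "sat M e (Conj \<phi> \<psi>) \<longleftrightarrow> sat M e \<phi> \<and> sat M e \<psi>"
| "sat M e (Ex x \<phi>) \<longleftrightarrow> (\<exists>a \<in> univ M. sat M (e(x := a)) \<phi>)"

definition complete_theory :: "'a struct \<Rightarrow> form set" where
  "complete_theory M =
     {\<phi>. fv \<phi> = {} \<and> (\<forall>e. range e \<subseteq> univ M \<longrightarrow> sat M e \<phi>)}"

definition is_model :: "'a struct \<Rightarrow> form set \<Rightarrow> bool" where
  "is_model M T \<longleftrightarrow> univ M \<noteq> {} \<and>
     (\<forall>\<phi> \<in> T. \<forall>e. range e \<subseteq> univ M \<longrightarrow> sat M e \<phi>)"

text \<open>Rado's coding: for \<open>x < y\<close>, there is an edge iff the \<open>x\<close>-th binary digit of \<open>y\<close> is 1.\<close>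

definition rado_graph :: "nat struct" where
  "rado_graph = Struct UNIV (\<lambda>x y. x < y \<and> bit y x \<or> y < x \<and> bit x y)"

definition random_graph_theory :: "form set" where
  "random_graph_theory = complete_theory rado_graph"

text \<open>
  A formula over \<open>A\<close> in the single free variable \<open>0\<close> is a pair \<open>(\<phi>, e)\<close>, where \<open>e\<close>
  assigns to the other free variables of \<open>\<phi>\<close> parameters in \<open>A\<close>; the remaining values of
  \<open>e\<close> are irrelevant. A \<open>1\<close>-type over \<open>A\<close> is a finitely satisfiable set of these.
\<close>

definition formulas_over :: "'a set \<Rightarrow> (form \<times> (nat \<Rightarrow> 'a)) set" where
  "formulas_over A = {(\<phi>, e). \<forall>n \<in> fv \<phi> - {0}. e n \<in> A}"

definition realizes :: "'a struct \<Rightarrow> 'a \<Rightarrow> (form \<times> (nat \<Rightarrow> 'a)) set \<Rightarrow> bool" where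
  "realizes M a p \<longleftrightarrow> (\<forall>(\<phi>, e) \<in> p. sat M (e(0 := a)) \<phi>)"

definition is_type :: "'a struct \<Rightarrow> 'a set \<Rightarrow> (form \<times> (nat \<Rightarrow> 'a)) set \<Rightarrow> bool" where
  "is_type M A p \<longleftrightarrow> p \<subseteq> formulas_over A \<and>
     (\<forall>q. q \<subseteq> p \<and> finite q \<longrightarrow> (\<exists>a \<in> univ M. realizes M a q))"

definition saturated :: "'r rel \<Rightarrow> 'a struct \<Rightarrow> bool" where
  "saturated r M \<longleftrightarrow>
     (\<forall>A p. A \<subseteq> univ M \<and> |A| <o r \<and> is_type M A p \<longrightarrow> (\<exists>a \<in> univ M. realizes M a p))"

end

theory Submission
  imports Defs
begin

text \<open>
  Write \<open>\<kappa>\<close> and \<open>\<lambda>\<close> for the index sets of \<open>E\<close> and \<open>D1\<close>, and \<open>D = D1 \<times> E\<close>. An ultrapower by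
  \<open>D\<close> is an ultrapower by \<open>E\<close> of an ultrapower by \<open>D1\<close>: a function on \<open>\<lambda> \<times> \<kappa>\<close> is a family of
  \<open>\<kappa>\<close> columns, each a function on \<open>\<lambda>\<close>.

  \<^emph>\<open>Lower cofinality.\<close> Goodness and regularity of \<open>D1\<close> give, for any \<open>\<lambda>\<close> nonstandard elements of
  \<open>\<nat>\<^sup>\<lambda>/D1\<close>, a nonstandard element below all of them (\<open>good_lower_bound\<close>), so that
  \<open>lcf D1 > \<lambda>\<close>. A function on \<open>\<lambda> \<times> \<kappa>\<close> represents a nonstandard element modulo \<open>D\<close> only if, for
  every \<open>n\<close>, almost all of its columns exceed \<open>n\<close>; as \<open>E\<close> is \<open>\<aleph>\<^sub>1\<close>-complete, almost all columns
  then exceed every \<open>n\<close>. There are only \<open>\<kappa> \<le> \<lambda>\<close> columns, so a single nonstandard element of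
  \<open>\<nat>\<^sup>\<lambda>/D1\<close> lies below almost all of them (\<open>lower_bound_columns\<close>). Hence the nonstandard elements
  that are constant across columns are coinitial among all, and the two lower cofinalities agree.

  \<^emph>\<open>Failure of saturation.\<close> This is a count of types against traces. Take \<open>\<kappa>\<close> distinct points of
  \<open>M\<^sup>\<lambda>/D1\<close>. Since \<open>\<kappa>\<close> is a strong limit, there are \<open>2\<^sup>\<kappa>\<close> functions from \<open>\<kappa>\<close> to \<open>\<kappa>\<close> that are
  pairwise different almost everywhere (\<open>eventually_different_family\<close>): they choose columns among the
  \<open>\<kappa>\<close> points, and give \<open>2\<^sup>\<kappa>\<close> distinct parameters in the ultrapower by \<open>D\<close>. Any set of these
  parameters defines a type, ``adjacent to exactly the parameters in this set'', because models of the
  theory of the random graph have the extension property. So there are \<open>2\<close> to the power \<open>2\<^sup>\<kappa>\<close>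
  such types. But which parameters are adjacent to a given element depends only on which of the \<open>\<kappa>\<close>
  points are adjacent to each of its columns, that is, on a function from \<open>\<kappa>\<close> to the power set of
  \<open>\<kappa>\<close>, and there are only \<open>2\<^sup>\<kappa>\<close> of those. So some type is omitted.
\<close>

section \<open>Ultrapowers\<close>

definition up_class :: "'i filter \<Rightarrow> 'a struct \<Rightarrow> ('i \<Rightarrow> 'a) \<Rightarrow> ('i \<Rightarrow> 'a) set" where
  "up_class D M f = up_eq D (univ M) `` {f}"

lemma diag_eq_up_class: "diag D M a = up_class D M (\<lambda>_. a)"
  by (simp add: diag_def up_class_def)

lemma mem_up_class:
  "range f \<subseteq> univ M \<Longrightarrow>
    g \<in> up_class D M f \<longleftrightarrow> range g \<subseteq> univ M \<and> eventually (\<lambda>i. f i = g i) D"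
  by (auto simp: up_class_def up_eq_def)

lemma up_class_cong:
  assumes "range f \<subseteq> univ M" "range g \<subseteq> univ M" "eventually (\<lambda>i. f i = g i) D"
  shows "up_class D M f = up_class D M g"
proof -
  have "eventually (\<lambda>i. f i = h i) D \<longleftrightarrow> eventually (\<lambda>i. g i = h i) D" for h
    by (rule eventually_cong[OF assms(3)]) simp
  then show ?thesis
    using assms by (auto simp: mem_up_class)
qed

lemma up_class_eq_iff:
  assumes "range f \<subseteq> univ M" "range g \<subseteq> univ M"
  shows "up_class D M f = up_class D M g \<longleftrightarrow> eventually (\<lambda>i. f i = g i) D"
proof
  assume "up_class D M f = up_class D M g"
  moreover have "g \<in> up_class D M g"
    using assms by (simp add: mem_up_class)
  ultimately have "g \<in> up_class D M f" by simp
  then show "eventually (\<lambda>i. f i = g i) D"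
    using mem_up_class[OF assms(1)] by blast
qed (rule up_class_cong[OF assms])

lemma univ_ultrapower: "univ (ultrapower D M) = up_class D M ` {f. range f \<subseteq> univ M}"
  by (auto simp: ultrapower_def quotient_def up_class_def)

text \<open>
  This is the theorem of Los for atomic formulas; the edge relation of the ultrapower quantifies
  over representatives, and the lemma says that any representatives will do.
\<close>

lemma edge_ultrapower:
  assumes "range f \<subseteq> univ M" "range g \<subseteq> univ M"
  shows "edge (ultrapower D M) (up_class D M f) (up_class D M g) \<longleftrightarrow>
    eventually (\<lambda>i. edge M (f i) (g i)) D"
proof -
  have "eventually (\<lambda>i. edge M (f i) (g i)) D"
    if "eventually (\<lambda>i. f i = f' i) D" "eventually (\<lambda>i. g i = g' i) D"
      "eventually (\<lambda>i. edge M (f' i) (g' i)) D" for f' g'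
    using that by eventually_elim simp
  moreover have "f \<in> up_class D M f" "g \<in> up_class D M g"
    using assms by (auto simp: mem_up_class)
  ultimately show ?thesis
    unfolding ultrapower_def struct.sel
    using mem_up_class[OF assms(1)] mem_up_class[OF assms(2)] by blast
qed

lemma ultrafilter_iff:
  "ultrafilter D \<longleftrightarrow> D \<noteq> bot \<and> (\<forall>P. eventually P D \<or> eventually (\<lambda>i. \<not> P i) D)"
proof -
  have "(\<forall>X. X \<in> members D \<or> - X \<in> members D) \<longleftrightarrow>
      (\<forall>P. eventually P D \<or> eventually (\<lambda>i. \<not> P i) D)"
    (is "?L = ?R")
  proof
    assume L: ?L
    show ?R
    proof
      fix P
      show "eventually P D \<or> eventually (\<lambda>i. \<not> P i) D"
        using L[rule_format, of "{i. P i}"] by (simp add: members_def)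
    qed
  qed (auto simp: members_def)
  then show ?thesis by (simp add: ultrafilter_def)
qed

lemma eventually_not_ultrafilter:
  assumes "ultrafilter D"
  shows "eventually (\<lambda>i. \<not> P i) D \<longleftrightarrow> \<not> eventually P D"
proof -
  have "\<not> (eventually P D \<and> eventually (\<lambda>i. \<not> P i) D)"
  proof
    assume "eventually P D \<and> eventually (\<lambda>i. \<not> P i) D"
    then have "eventually (\<lambda>i. P i \<and> \<not> P i) D"
      using eventually_conj by blast
    then have "eventually (\<lambda>i. False) D" by simp
    with assms show False by (simp add: ultrafilter_iff trivial_limit_def)
  qed
  with assms show ?thesis unfolding ultrafilter_iff by blast
qed

lemma ultrafilter_product:
  assumes "ultrafilter D1" "ultrafilter E"
  shows "ultrafilter (product_ultrafilter D1 E)"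
proof -
  have "product_ultrafilter D1 E \<noteq> bot"
    using assms by (simp add: ultrafilter_iff trivial_limit_def eventually_product_ultrafilter)
  moreover have "eventually P (product_ultrafilter D1 E) \<or>
      eventually (\<lambda>x. \<not> P x) (product_ultrafilter D1 E)" for P
    unfolding eventually_product_ultrafilter
    using assms by (simp add: eventually_not_ultrafilter)
  ultimately show ?thesis by (simp add: ultrafilter_iff)
qed

lemma regular_filter_product:
  fixes D1 :: "'l filter" and E :: "'k filter"
  assumes "regular_filter D1" and "|UNIV :: ('l \<times> 'k) set| \<le>o |UNIV :: 'l set|"
  shows "regular_filter (product_ultrafilter D1 E)"
proof -
  obtain X :: "'l \<Rightarrow> 'l set" where X: "\<And>i. X i \<in> members D1" "\<And>t. finite {i. t \<in> X i}"
    using assms(1) unfolding regular_filter_def by blast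
  \<comment> \<open>The cylinders over the \<open>X i\<close> are regularizing; \<open>p\<close> only reindexes them by \<open>'l \<times> 'k\<close>.\<close>
  obtain p :: "'l \<times> 'k \<Rightarrow> 'l" where p: "inj p"
    using assms(2) by (auto simp flip: card_of_ordLeq)
  have "X (p i) \<times> UNIV \<in> members (product_ultrafilter D1 E)" for i
    using X(1)[of "p i"] by (simp add: members_def eventually_product_ultrafilter)
  moreover have "finite {i. t \<in> X (p i) \<times> (UNIV :: 'k set)}" for t
  proof -
    have "{i. t \<in> X (p i) \<times> (UNIV :: 'k set)} = p -` {i. fst t \<in> X i}"
      by (auto simp: mem_Times_iff)
    then show ?thesis using finite_vimageI[OF X(2) p] by simp
  qed
  ultimately show ?thesis
    unfolding regular_filter_def by (intro exI[of _ "\<lambda>i. X (p i) \<times> UNIV"]) blast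
qed

section \<open>Lower cofinality\<close>

definition inf_large :: "'i filter \<Rightarrow> ('i \<Rightarrow> nat) \<Rightarrow> bool" where
  "inf_large D f \<longleftrightarrow> (\<forall>n. eventually (\<lambda>i. n < f i) D)"

text \<open>
  The comparison is strict. As \<open>\<lambda>i. f i - 1\<close> is as large as \<open>f\<close>, this is no stronger than asking
  for \<open>g \<le> f\<close> almost everywhere, and unlike \<open>lcf_order\<close> it needs no case distinction.
\<close>

definition coinitial :: "'i filter \<Rightarrow> ('i \<Rightarrow> nat) set \<Rightarrow> bool" where
  "coinitial D F \<longleftrightarrow> (\<forall>f \<in> F. inf_large D f) \<and>
     (\<forall>f. inf_large D f \<longrightarrow> (\<exists>g \<in> F. eventually (\<lambda>i. g i < f i) D))"

definition lcf_order :: "'i filter \<Rightarrow> ('i \<Rightarrow> nat) set rel" where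
  "lcf_order D = {(X, Y). X \<in> above_diag D \<and> Y \<in> above_diag D \<and>
     (Y = X \<or> edge (ultrapower D nat_struct) Y X)}"

lemma Field_lcf_order: "Field (lcf_order D) = above_diag D"
  by (auto simp: lcf_order_def Field_def)

lemma nat_struct_sel: "univ nat_struct = UNIV" "edge nat_struct = (<)"
  by (simp_all add: nat_struct_def)

lemma up_class_in_above_diag:
  "up_class D nat_struct f \<in> above_diag D \<longleftrightarrow> inf_large D f"
  by (simp add: above_diag_def inf_large_def univ_ultrapower diag_eq_up_class
      edge_ultrapower nat_struct_sel)

lemma above_diag_eq: "above_diag D = up_class D nat_struct ` {f. inf_large D f}"
  by (auto simp: up_class_in_above_diag)
    (auto simp: above_diag_def univ_ultrapower diag_eq_up_class inf_large_def
      edge_ultrapower nat_struct_sel)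

lemma lcf_minimal_cofinal:
  obtains B where "cofinal_subset B (lcf_order D)" "lcf D = |B|"
    "\<And>B'. cofinal_subset B' (lcf_order D) \<Longrightarrow> |B| \<le>o |B'|"
proof -
  have "\<exists>B. cofinal_subset B (lcf_order D) \<and>
      (\<forall>B'. cofinal_subset B' (lcf_order D) \<longrightarrow> |B| \<le>o |B'| )"
    by (rule ex_minimal_cofinal_subset) (auto simp: Field_lcf_order, simp add: lcf_order_def)
  from someI_ex[OF this] show thesis
    using that unfolding lcf_def cofinality_def lcf_order_def[symmetric] by blast
qed

lemma lcf_le_coinitial:
  assumes "coinitial D F"
  shows "lcf D \<le>o |F|"
proof -
  have "cofinal_subset (up_class D nat_struct ` F) (lcf_order D)"
    unfolding cofinal_subset_def Field_lcf_order
  proof (intro conjI ballI)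
    show "up_class D nat_struct ` F \<subseteq> above_diag D"
      using assms by (auto simp: coinitial_def up_class_in_above_diag)
    fix X assume "X \<in> above_diag D"
    then obtain f where f: "inf_large D f" "X = up_class D nat_struct f"
      by (auto simp: above_diag_eq)
    with assms obtain g where g: "g \<in> F" "inf_large D g" "eventually (\<lambda>i. g i < f i) D"
      unfolding coinitial_def by blast
    then have "(X, up_class D nat_struct g) \<in> lcf_order D"
      using f by (simp add: lcf_order_def up_class_in_above_diag edge_ultrapower nat_struct_sel)
    with g(1) show "\<exists>b \<in> up_class D nat_struct ` F. (X, b) \<in> lcf_order D" by blast
  qed
  then have "lcf D \<le>o |up_class D nat_struct ` F|"
    by (metis lcf_minimal_cofinal)
  then show ?thesis
    using card_of_image ordLeq_transitive by blast
qed

lemma ex_coinitial_le_lcf: "\<exists>F. coinitial D F \<and> |F| \<le>o lcf D"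
proof -
  obtain B where B: "cofinal_subset B (lcf_order D)" "lcf D = |B|"
    by (metis lcf_minimal_cofinal)
  have "\<exists>f. inf_large D f \<and> X = up_class D nat_struct f" if "X \<in> B" for X
    using B(1) that unfolding cofinal_subset_def Field_lcf_order above_diag_eq by blast
  then obtain rep where rep: "\<And>X. X \<in> B \<Longrightarrow> inf_large D (rep X) \<and> X = up_class D nat_struct (rep X)"
    by metis
  have "\<exists>g \<in> rep ` B. eventually (\<lambda>i. g i < f i) D" if f: "inf_large D f" for f
  proof -
    \<comment> \<open>A lower bound of \<open>f - 1\<close> in the weak order is a lower bound of \<open>f\<close> in the strict one.\<close>
    have "inf_large D (\<lambda>i. f i - 1)"
      unfolding inf_large_def
    proof
      fix n
      show "eventually (\<lambda>i. n < f i - 1) D"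
        using f[unfolded inf_large_def, rule_format, of "Suc n"] by eventually_elim simp
    qed
    then have "up_class D nat_struct (\<lambda>i. f i - 1) \<in> Field (lcf_order D)"
      by (simp add: Field_lcf_order up_class_in_above_diag)
    then obtain X where X: "X \<in> B" "(up_class D nat_struct (\<lambda>i. f i - 1), X) \<in> lcf_order D"
      using B(1) unfolding cofinal_subset_def by blast
    define g where "g = rep X"
    have "X = up_class D nat_struct g"
      using rep X(1) by (simp add: g_def)
    with X(2) have "eventually (\<lambda>i. g i = f i - 1) D \<or> eventually (\<lambda>i. g i < f i - 1) D"
      by (simp add: lcf_order_def up_class_eq_iff edge_ultrapower nat_struct_sel)
    then have "eventually (\<lambda>i. g i \<le> f i - 1) D"
      by (auto elim: eventually_mono)
    moreover have "eventually (\<lambda>i. 0 < f i) D"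
      using f by (simp add: inf_large_def)
    ultimately have "eventually (\<lambda>i. g i < f i) D"
      by eventually_elim simp
    then show ?thesis using X(1) g_def by blast
  qed
  then have "coinitial D (rep ` B)"
    using rep by (auto simp: coinitial_def)
  then show ?thesis
    using B(2) card_of_image by metis
qed

text \<open>
  The number of regularizing sets that contain \<open>t\<close> is finite for each \<open>t\<close>, and it is at least \<open>n\<close>
  on the intersection of any \<open>n\<close> of these sets.
\<close>

lemma regular_inf_large:
  fixes D :: "'i filter"
  assumes "regular_filter D" "infinite (UNIV :: 'i set)"
  shows "\<exists>c. inf_large D c"
proof -
  obtain X :: "'i \<Rightarrow> 'i set" where X: "\<And>i. X i \<in> members D" "\<And>t. finite {i. t \<in> X i}"
    using assms(1) unfolding regular_filter_def by blast
  have "eventually (\<lambda>t. n < card {i. t \<in> X i}) D" for n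
  proof -
    obtain u :: "'i set" where u: "finite u" "card u = Suc n"
      using infinite_arbitrarily_large[OF assms(2)] by blast
    have "eventually (\<lambda>t. \<forall>i \<in> u. t \<in> X i) D"
      using u(1) X(1) by (simp add: eventually_ball_finite members_def)
    then show ?thesis
    proof eventually_elim
      case (elim t)
      then have "card u \<le> card {i. t \<in> X i}"
        by (intro card_mono X(2)) auto
      then show ?case using u(2) by simp
    qed
  qed
  then show ?thesis
    by (intro exI[of _ "\<lambda>t. card {i. t \<in> X i}"]) (simp add: inf_large_def)
qed

lemma multiplicative_Fpow:
  assumes "\<forall>u \<in> Fpow M. \<forall>v \<in> Fpow M. g u \<inter> g v = g (u \<union> v)"
    and "finite u" "u \<noteq> {}" "u \<subseteq> M" "\<And>a. a \<in> u \<Longrightarrow> t \<in> g {a}"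
  shows "t \<in> g u"
  using assms(2-)
proof (induction rule: finite_ne_induct)
  case (insert a u)
  have "g {a} \<inter> g u = g ({a} \<union> u)"
    using insert.prems(1) insert.hyps assms(1) by (auto simp: Fpow_def)
  then show ?case using insert by auto
qed auto

text \<open>
  The height at \<open>t\<close> of the lower bound is the number of \<open>a\<close> with \<open>t \<in> g {a}\<close>, where \<open>g\<close> refines
  multiplicatively the map sending \<open>u\<close> to the set of points at which all \<open>f a\<close> with \<open>a \<in> u\<close> exceed
  \<open>card u\<close>. By multiplicativity \<open>t\<close> belongs to \<open>g\<close> of the whole set of these \<open>a\<close>, so that \<open>f a t\<close>
  exceeds its cardinality. The function \<open>c\<close> ensures that this set is finite.
\<close>

lemma good_lower_bound:
  fixes D :: "'i filter" and f :: "'m \<Rightarrow> 'i \<Rightarrow> nat"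
  assumes good: "succ_good M D" and M: "infinite M"
    and c: "inf_large D c" and f: "\<And>a. a \<in> M \<Longrightarrow> inf_large D (f a)"
  shows "\<exists>h. inf_large D h \<and> (\<forall>a \<in> M. eventually (\<lambda>i. h i < f a i) D)"
proof -
  define F where "F u = {t. card u < c t \<and> (\<forall>a \<in> u. card u < f a t)}" for u
  have "F u \<in> members D" if "u \<in> Fpow M" for u
  proof -
    have "eventually (\<lambda>t. \<forall>a \<in> u. card u < f a t) D"
      using that f by (intro eventually_ball_finite) (auto simp: Fpow_def inf_large_def)
    then show ?thesis
      using c by (simp add: F_def members_def inf_large_def eventually_conj_iff)
  qed
  then obtain g where g: "\<And>u. u \<in> Fpow M \<Longrightarrow> g u \<in> members D \<and> g u \<subseteq> F u"
    and mult: "\<forall>u \<in> Fpow M. \<forall>v \<in> Fpow M. g u \<inter> g v = g (u \<union> v)"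
    using good unfolding succ_good_def by metis
  define w where "w t = {a \<in> M. t \<in> g {a}}" for t
  have in_F: "t \<in> F v" if "v \<subseteq> w t" "finite v" "v \<noteq> {}" for t v
  proof -
    have "v \<subseteq> M" using that(1) by (auto simp: w_def)
    then show ?thesis
      using multiplicative_Fpow[OF mult that(2,3), of t] that g[of v]
      by (auto simp: w_def Fpow_def)
  qed
  have fin: "finite (w t)" for t
  proof (rule ccontr)
    assume "infinite (w t)"
    then obtain v where v: "v \<subseteq> w t" "finite v" "card v = Suc (c t)"
      using infinite_arbitrarily_large by blast
    with in_F[of v t] show False by (force simp: F_def)
  qed
  have below: "card (w t) < f a t" if "a \<in> M" "t \<in> g {a}" for a t
  proof -
    have "a \<in> w t" using that by (simp add: w_def)
    then show ?thesis using in_F[OF order_refl fin] by (auto simp: F_def)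
  qed
  show ?thesis
  proof (intro exI conjI ballI)
    fix a assume a: "a \<in> M"
    then have "eventually (\<lambda>t. t \<in> g {a}) D"
      using g[of "{a}"] by (simp add: Fpow_def members_def)
    then show "eventually (\<lambda>i. card (w i) < f a i) D"
      by eventually_elim (rule below[OF a])
  next
    show "inf_large D (\<lambda>i. card (w i))"
      unfolding inf_large_def
    proof
      fix n
      obtain u where u: "u \<subseteq> M" "finite u" "card u = Suc n"
        using infinite_arbitrarily_large[OF M] by blast
      have "eventually (\<lambda>t. \<forall>a \<in> u. t \<in> g {a}) D"
        using u g by (intro eventually_ball_finite) (auto simp: Fpow_def members_def)
      then show "eventually (\<lambda>t. n < card (w t)) D"
      proof eventually_elim
        case (elim t)
        then have "u \<subseteq> w t" using u(1) by (auto simp: w_def)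
        then have "card u \<le> card (w t)" by (rule card_mono[OF fin])
        then show ?case using u(3) by simp
      qed
    qed
  qed
qed

lemma good_regular_lower_bound:
  fixes D :: "'l filter"
  assumes "succ_good (UNIV :: 'l set) D" "regular_filter D" "infinite (UNIV :: 'l set)"
    and C: "\<And>f. f \<in> C \<Longrightarrow> inf_large D f" "|C| \<le>o |UNIV :: 'l set|"
  shows "\<exists>h. inf_large D h \<and> (\<forall>f \<in> C. eventually (\<lambda>i. h i < f i) D)"
proof (cases "C = {}")
  case True
  then show ?thesis using regular_inf_large[OF assms(2,3)] by simp
next
  case False
  obtain e :: "'l \<Rightarrow> 'l \<Rightarrow> nat" where e: "range e = C"
    using iffD2[OF card_of_ordLeq2[OF False] C(2)] by blast
  obtain c where c: "inf_large D c"
    using regular_inf_large[OF assms(2,3)] by blast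
  have "inf_large D (e a)" for a
    using e C(1) by blast
  then obtain h where "inf_large D h" "\<And>a. eventually (\<lambda>i. h i < e a i) D"
    using good_lower_bound[OF assms(1,3) c, of e] by blast
  then show ?thesis using e by blast
qed

text \<open>
  A coinitial family of size at most \<open>\<lambda>\<close> would have a lower bound, and some member of the family
  would lie below that bound.
\<close>

lemma lcf_good_regular:
  fixes D :: "'l filter"
  assumes "succ_good (UNIV :: 'l set) D" "regular_filter D" "infinite (UNIV :: 'l set)"
    and "D \<noteq> bot"
  shows "cardSuc |UNIV :: 'l set| \<le>o lcf D"
proof -
  obtain F where F: "coinitial D F" "|F| \<le>o lcf D"
    using ex_coinitial_le_lcf by blast
  have "\<not> |F| \<le>o |UNIV :: 'l set|"
  proof
    assume "|F| \<le>o |UNIV :: 'l set|"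
    then obtain h where h: "inf_large D h" "\<And>f. f \<in> F \<Longrightarrow> eventually (\<lambda>i. h i < f i) D"
      using good_regular_lower_bound[OF assms(1-3), of F] F(1) unfolding coinitial_def by blast
    then obtain g where "g \<in> F" "eventually (\<lambda>i. g i < h i) D"
      using F(1) unfolding coinitial_def by blast
    with h(2) have "eventually (\<lambda>i. g i < h i \<and> h i < g i) D"
      by (simp add: eventually_conj_iff)
    then have "eventually (\<lambda>i. False) D" by (rule eventually_mono) linarith
    with assms(4) show False by (simp add: trivial_limit_def)
  qed
  then have "|UNIV :: 'l set| <o |F|"
    by (simp add: not_ordLeq_iff_ordLess card_of_Well_order)
  then have "cardSuc |UNIV :: 'l set| \<le>o |F|"
    by (simp add: cardSuc_ordLess_ordLeq card_of_Card_order)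
  then show ?thesis using F(2) ordLeq_transitive by blast
qed

lemma eventually_all_nat:
  fixes P :: "nat \<Rightarrow> 'k \<Rightarrow> bool"
  assumes "complete_filter (cardSuc natLeq) E" "\<And>n. eventually (P n) E"
  shows "eventually (\<lambda>t. \<forall>n. P n t) E"
proof -
  let ?X = "range (\<lambda>n. {t. P n t})"
  have "|?X| \<le>o natLeq"
    by (rule ordLeq_ordIso_trans[OF card_of_image card_of_nat])
  then have "|?X| <o cardSuc natLeq"
    by (rule ordLeq_ordLess_trans[OF _ cardSuc_greater[OF natLeq_Card_order]])
  moreover have "?X \<subseteq> members E"
    using assms(2) by (auto simp: members_def)
  ultimately have "\<Inter> ?X \<in> members E"
    using assms(1) unfolding complete_filter_def by blast
  then show ?thesis by (simp add: members_def)
qed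

text \<open>
  Almost all columns of \<open>f\<close> are infinitely large, by \<open>\<aleph>\<^sub>1\<close>-completeness of \<open>E\<close>. They are few enough
  to have a common lower bound modulo \<open>D1\<close>.
\<close>

lemma lower_bound_columns:
  fixes D1 :: "'l filter" and E :: "'k filter"
  assumes "succ_good (UNIV :: 'l set) D1" "regular_filter D1" "infinite (UNIV :: 'l set)"
    and "|UNIV :: 'k set| \<le>o |UNIV :: 'l set|"
    and "complete_filter (cardSuc natLeq) E"
    and f: "inf_large (product_ultrafilter D1 E) f"
  shows "\<exists>h. inf_large D1 h \<and> eventually (\<lambda>(s, t). h s < f (s, t)) (product_ultrafilter D1 E)"
proof -
  define C where "C = (\<lambda>t s. f (s, t)) ` {t. inf_large D1 (\<lambda>s. f (s, t))}"
  have "|C| \<le>o |UNIV :: 'k set|"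
    unfolding C_def by (rule ordLeq_transitive[OF card_of_image card_of_mono1[OF subset_UNIV]])
  then have "|C| \<le>o |UNIV :: 'l set|"
    using assms(4) by (rule ordLeq_transitive)
  moreover have "inf_large D1 c" if "c \<in> C" for c
    using that by (auto simp: C_def)
  ultimately obtain h where h: "inf_large D1 h" "\<And>c. c \<in> C \<Longrightarrow> eventually (\<lambda>i. h i < c i) D1"
    using good_regular_lower_bound[OF assms(1-3), of C] by blast
  have "eventually (\<lambda>t. inf_large D1 (\<lambda>s. f (s, t))) E"
    unfolding inf_large_def
    by (rule eventually_all_nat[OF assms(5)])
      (use f in \<open>simp add: inf_large_def eventually_product_ultrafilter\<close>)
  then have "eventually (\<lambda>t. eventually (\<lambda>s. h s < f (s, t)) D1) E"
    by eventually_elim (use h(2) in \<open>auto simp: C_def\<close>)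
  then show ?thesis using h(1) by (auto simp: eventually_product_ultrafilter)
qed

text \<open>
  Coinitial families pass in both directions: from \<open>D1\<close> to the product by composition with \<open>fst\<close>,
  and back by replacing each \<open>f\<close> by a common lower bound of its columns.
\<close>

lemma lcf_product:
  fixes D1 :: "'l filter" and E :: "'k filter"
  assumes "succ_good (UNIV :: 'l set) D1" "regular_filter D1" "infinite (UNIV :: 'l set)"
    and "|UNIV :: 'k set| \<le>o |UNIV :: 'l set|"
    and "complete_filter (cardSuc natLeq) E" and "E \<noteq> bot"
  shows "lcf (product_ultrafilter D1 E) =o lcf D1"
proof -
  let ?D = "product_ultrafilter D1 E"
  note lower = lower_bound_columns[OF assms(1-5)]
  have large_fst: "inf_large ?D (g \<circ> fst) \<longleftrightarrow> inf_large D1 g" for g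
    using assms(6) by (simp add: inf_large_def eventually_product_ultrafilter eventually_const_iff)
  have "lcf ?D \<le>o lcf D1"
  proof -
    obtain F where F: "coinitial D1 F" "|F| \<le>o lcf D1"
      using ex_coinitial_le_lcf by blast
    have "coinitial ?D ((\<lambda>g. g \<circ> fst) ` F)"
      unfolding coinitial_def
    proof (intro conjI ballI allI impI)
      show "inf_large ?D g" if "g \<in> (\<lambda>g. g \<circ> fst) ` F" for g
        using that F(1) large_fst by (auto simp: coinitial_def)
      fix f assume "inf_large ?D f"
      then obtain h where h: "inf_large D1 h" "eventually (\<lambda>(s, t). h s < f (s, t)) ?D"
        using lower by blast
      then obtain g where g: "g \<in> F" "eventually (\<lambda>s. g s < h s) D1"
        using F(1) unfolding coinitial_def by blast
      then have "eventually (\<lambda>(s, t). g s < h s) ?D"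
        by (simp add: eventually_product_ultrafilter)
      with h(2) have "eventually (\<lambda>x. (g \<circ> fst) x < f x) ?D"
        by eventually_elim auto
      with g(1) show "\<exists>g \<in> (\<lambda>g. g \<circ> fst) ` F. eventually (\<lambda>x. g x < f x) ?D" by blast
    qed
    then show ?thesis
      by (rule ordLeq_transitive[OF lcf_le_coinitial ordLeq_transitive[OF card_of_image F(2)]])
  qed
  moreover have "lcf D1 \<le>o lcf ?D"
  proof -
    obtain F where F: "coinitial ?D F" "|F| \<le>o lcf ?D"
      using ex_coinitial_le_lcf by blast
    then have "\<forall>f \<in> F. \<exists>h. inf_large D1 h \<and> eventually (\<lambda>(s, t). h s < f (s, t)) ?D"
      using lower by (simp add: coinitial_def)
    then obtain h where h: "\<And>f. f \<in> F \<Longrightarrow> inf_large D1 (h f)"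
      "\<And>f. f \<in> F \<Longrightarrow> eventually (\<lambda>(s, t). h f s < f (s, t)) ?D"
      by metis
    have "coinitial D1 (h ` F)"
      unfolding coinitial_def
    proof (intro conjI ballI allI impI)
      show "inf_large D1 g" if "g \<in> h ` F" for g
        using that h(1) by auto
      fix a assume "inf_large D1 a"
      then obtain f where f: "f \<in> F" "eventually (\<lambda>x. f x < (a \<circ> fst) x) ?D"
        using F(1) large_fst unfolding coinitial_def by blast
      from f(2) h(2)[OF f(1)] have "eventually (\<lambda>(s, t). h f s < a s) ?D"
        by eventually_elim auto
      then have "eventually (\<lambda>s. h f s < a s) D1"
        using assms(6) by (simp add: eventually_product_ultrafilter eventually_const_iff)
      then show "\<exists>g \<in> h ` F. eventually (\<lambda>x. g x < a x) D1" using f(1) by blast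
    qed
    then show ?thesis
      by (rule ordLeq_transitive[OF lcf_le_coinitial ordLeq_transitive[OF card_of_image F(2)]])
  qed
  ultimately show ?thesis by (simp add: ordIso_iff_ordLeq)
qed

section \<open>The extension property of models of the theory of the random graph\<close>

definition valid :: "'a struct \<Rightarrow> form \<Rightarrow> bool" where
  "valid M \<phi> \<longleftrightarrow> (\<forall>e. range e \<subseteq> univ M \<longrightarrow> sat M e \<phi>)"

definition Forall :: "nat \<Rightarrow> form \<Rightarrow> form" where
  "Forall x \<phi> = Neg (Ex x (Neg \<phi>))"

definition universal_closure :: "form \<Rightarrow> form" where
  "universal_closure \<phi> = foldr Forall (sorted_list_of_set (fv \<phi>)) \<phi>"

primrec Conjs :: "form list \<Rightarrow> form" where
  "Conjs [] = Forall 0 (Eq 0 0)"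
| "Conjs (\<phi> # \<phi>s) = Conj \<phi> (Conjs \<phi>s)"

text \<open>
  The formula says that if no value of a variable in \<open>us\<close> is the value of a variable in \<open>vs\<close>, then
  some point is adjacent to all values of the former and to none of the latter. Its free variables
  may coincide in value, so it has an instance for any two disjoint finite sets.
\<close>

definition extension_formula :: "nat list \<Rightarrow> nat list \<Rightarrow> form" where
  "extension_formula us vs =
     Neg (Conj (Conjs [Neg (Eq u v). u \<leftarrow> us, v \<leftarrow> vs])
       (Neg (Ex 0 (Conj (Conjs [Rel 0 u. u \<leftarrow> us]) (Conjs [Neg (Rel 0 v). v \<leftarrow> vs])))))"

lemma finite_fv: "finite (fv \<phi>)"
  by (induction \<phi>) auto

lemma fv_universal_closure: "fv (universal_closure \<phi>) = {}"
proof -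
  have "fv (foldr Forall xs \<phi>) = fv \<phi> - set xs" for xs
    by (induction xs) (auto simp: Forall_def)
  then show ?thesis by (simp add: universal_closure_def finite_fv)
qed

lemma valid_Forall: "valid M (Forall x \<phi>) \<longleftrightarrow> valid M \<phi>"
proof
  assume L: "valid M (Forall x \<phi>)"
  show "valid M \<phi>"
    unfolding valid_def
  proof (intro allI impI)
    fix e :: "nat \<Rightarrow> 'a" assume e: "range e \<subseteq> univ M"
    then have "e x \<in> univ M" by auto
    then have "sat M (e(x := e x)) \<phi>"
      using L e by (simp add: valid_def Forall_def del: fun_upd_triv)
    then show "sat M e \<phi>" by simp
  qed
next
  assume "valid M \<phi>"
  moreover have "range (e(x := a)) \<subseteq> univ M" if "range e \<subseteq> univ M" "a \<in> univ M" for e a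
    using that by auto
  ultimately show "valid M (Forall x \<phi>)"
    by (simp add: valid_def Forall_def)
qed

lemma valid_universal_closure: "valid M (universal_closure \<phi>) \<longleftrightarrow> valid M \<phi>"
proof -
  have "valid M (foldr Forall xs \<phi>) \<longleftrightarrow> valid M \<phi>" for xs
    by (induction xs) (simp_all add: valid_Forall)
  then show ?thesis by (simp add: universal_closure_def)
qed

text \<open>
  The theory consists of sentences only, and a formula is valid iff its universal closure is; so
  models of the theory inherit validity of open formulas as well, the extension formulas among them.
\<close>

lemma valid_transfer:
  assumes "is_model M random_graph_theory" "valid rado_graph \<phi>"
  shows "valid M \<phi>"
proof -
  have "universal_closure \<phi> \<in> random_graph_theory"
    using assms(2) valid_universal_closure[of rado_graph \<phi>]
    by (simp add: random_graph_theory_def complete_theory_def fv_universal_closure valid_def)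
  then have "valid M (universal_closure \<phi>)"
    using assms(1) by (simp add: is_model_def valid_def)
  then show ?thesis by (simp add: valid_universal_closure)
qed

lemma sat_Conjs: "sat M e (Conjs \<phi>s) \<longleftrightarrow> (\<forall>\<phi> \<in> set \<phi>s. sat M e \<phi>)"
  by (induction \<phi>s) (simp_all add: Forall_def)

lemma sat_extension_formula:
  assumes "0 \<notin> set us" "0 \<notin> set vs"
  shows "sat M e (extension_formula us vs) \<longleftrightarrow>
    (e ` set us \<inter> e ` set vs = {} \<longrightarrow>
      (\<exists>z \<in> univ M. (\<forall>a \<in> e ` set us. edge M z a) \<and> (\<forall>a \<in> e ` set vs. \<not> edge M z a)))"
proof -
  have "(e(0 := z)) u = e u" if "u \<in> set us \<union> set vs" for z u
    using that assms by auto
  then have "sat M e (Ex 0 (Conj (Conjs [Rel 0 u. u \<leftarrow> us]) (Conjs [Neg (Rel 0 v). v \<leftarrow> vs]))) \<longleftrightarrow>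
      (\<exists>z \<in> univ M. (\<forall>a \<in> e ` set us. edge M z a) \<and> (\<forall>a \<in> e ` set vs. \<not> edge M z a))"
    by (simp add: sat_Conjs)
  moreover have "sat M e (Conjs [Neg (Eq u v). u \<leftarrow> us, v \<leftarrow> vs]) \<longleftrightarrow>
      e ` set us \<inter> e ` set vs = {}"
    by (auto simp: sat_Conjs)
  ultimately show ?thesis
    by (simp add: extension_formula_def)
qed

lemma ex_nat_bits:
  fixes U :: "nat set"
  assumes "finite U"
  shows "\<exists>z :: nat. \<forall>n. bit z n \<longleftrightarrow> n \<in> U"
  using assms
proof induction
  case empty
  show ?case by (intro exI[of _ 0]) simp
next
  case (insert m U)
  then obtain z :: nat where "\<forall>n. bit z n \<longleftrightarrow> n \<in> U" by blast
  then show ?case by (intro exI[of _ "set_bit m z"]) (auto simp: bit_set_bit_iff)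
qed

lemma bit_nat_less: "bit z n \<Longrightarrow> n < z" for z n :: nat
proof -
  assume "bit z n"
  then have "odd (z div 2 ^ n)" by (simp add: bit_iff_odd)
  then have "z div 2 ^ n \<noteq> 0" by (metis even_zero)
  then have "2 ^ n \<le> z" by (metis div_less linorder_not_less)
  then show "n < z" using less_exp[of n] by linarith
qed

text \<open>
  The witness \<open>z\<close> has binary digits \<open>1\<close> exactly at the elements of \<open>U\<close> and at one position \<open>N\<close>
  beyond \<open>U\<close> and \<open>V\<close>. The extra digit makes \<open>z\<close> larger than all elements of \<open>U\<close> and \<open>V\<close>, so that its
  adjacency to them is decided by the digits of \<open>z\<close> and not by theirs.
\<close>

lemma rado_graph_extension:
  assumes "finite U" "finite V" "U \<inter> V = {}"
  shows "\<exists>z. (\<forall>u \<in> U. edge rado_graph z u) \<and> (\<forall>v \<in> V. \<not> edge rado_graph z v)"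
proof -
  obtain N where N: "\<forall>x \<in> U \<union> V. x < N"
    using assms finite_nat_set_iff_bounded by (meson finite_UnI)
  obtain z :: nat where z: "\<forall>n. bit z n \<longleftrightarrow> n \<in> insert N U"
    using ex_nat_bits[of "insert N U"] assms(1) by blast
  have "N < z" using z bit_nat_less by blast
  then have less: "x < z" if "x \<in> U \<union> V" for x
    using N that less_trans by blast
  have "edge rado_graph z u" if "u \<in> U" for u
    using less[of u] z that by (simp add: rado_graph_def)
  moreover have "\<not> edge rado_graph z v" if "v \<in> V" for v
  proof -
    have "v < z" "v \<noteq> N" "v \<notin> U"
      using less N that assms(3) by auto
    then show ?thesis using z by (simp add: rado_graph_def)
  qed
  ultimately show ?thesis by blast
qed

lemma extension_property:
  assumes "is_model M random_graph_theory"
    and "finite U" "finite V" "U \<subseteq> univ M" "V \<subseteq> univ M" "U \<inter> V = {}"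
  shows "\<exists>z \<in> univ M. (\<forall>u \<in> U. edge M z u) \<and> (\<forall>v \<in> V. \<not> edge M z v)"
proof -
  obtain us vs where uv: "set us = U" "set vs = V"
    using assms(2,3) finite_list by metis
  obtain m where m: "m \<in> univ M"
    using assms(1) by (auto simp: is_model_def)
  \<comment> \<open>Variable \<open>0\<close> is bound in the extension formula, hence the dummy value \<open>m\<close> in front.\<close>
  let ?xs = "m # us @ vs"
  define e where "e i = (if i < length ?xs then ?xs ! i else m)" for i
  define ps where "ps = [1..<Suc (length us)]"
  define qs where "qs = [Suc (length us)..<length ?xs]"
  have nz: "0 \<notin> set ps" "0 \<notin> set qs" by (auto simp: ps_def qs_def)
  have "e ` set ps = U"
  proof -
    have "map e ps = us"
      by (rule nth_equalityI) (auto simp: ps_def e_def nth_append simp del: upt_Suc)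
    then show ?thesis using uv by (metis set_map)
  qed
  moreover have "e ` set qs = V"
  proof -
    have "map e qs = vs"
      by (rule nth_equalityI) (auto simp: qs_def e_def nth_append simp del: upt_Suc)
    then show ?thesis using uv by (metis set_map)
  qed
  moreover have "range e \<subseteq> univ M"
  proof
    fix x assume "x \<in> range e"
    then obtain i where "x = e i" by blast
    then have "x \<in> set ?xs"
      by (cases "i < length ?xs") (simp_all only: e_def if_True if_False nth_mem list.set_intros)
    then show "x \<in> univ M" using uv m assms(4,5) by auto
  qed
  moreover have "valid M (extension_formula ps qs)"
  proof (rule valid_transfer[OF assms(1)])
    have "e ` set ps \<inter> e ` set qs = {} \<Longrightarrow>
        \<exists>z. (\<forall>a \<in> e ` set ps. edge rado_graph z a) \<and> (\<forall>a \<in> e ` set qs. \<not> edge rado_graph z a)"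
      for e
      by (rule rado_graph_extension) auto
    moreover have "univ rado_graph = UNIV" by (simp add: rado_graph_def)
    ultimately show "valid rado_graph (extension_formula ps qs)"
      unfolding valid_def sat_extension_formula[OF nz] by simp
  qed
  ultimately show ?thesis
    using assms(6) sat_extension_formula[OF nz, of M e] by (simp add: valid_def)
qed

text \<open>
  This is Cantor's diagonal argument: in a finite model, some point \<open>z\<close> would be adjacent to exactly
  the points not adjacent to themselves, which is absurd at \<open>z\<close>.
\<close>

lemma random_graph_model_infinite:
  assumes "is_model M random_graph_theory"
  shows "infinite (univ M)"
proof
  assume fin: "finite (univ M)"
  let ?U = "{x \<in> univ M. \<not> edge M x x}" and ?V = "{x \<in> univ M. edge M x x}"
  have "\<exists>z \<in> univ M. (\<forall>u \<in> ?U. edge M z u) \<and> (\<forall>v \<in> ?V. \<not> edge M z v)"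
    using fin by (intro extension_property[OF assms]) auto
  then show False by blast
qed

section \<open>Failure of saturation\<close>

text \<open>
  Otherwise the points of \<open>\<kappa>\<close> inject into the subsets of \<open>B\<close>. For each \<open>b \<in> B\<close> the ultrafilter
  decides whether \<open>b\<close> belongs to the subset assigned to a point, and completeness allows all these
  decisions to be met at once. A point is determined by them, so the ultrafilter contains a singleton.
\<close>

lemma measurable_strong_limit:
  fixes B :: "'k set"
  assumes meas: "measurable_cardinal |UNIV :: 'k set|" and B: "|B| <o |UNIV :: 'k set|"
  shows "|Pow B| \<le>o |UNIV :: 'k set|"
proof (rule ccontr)
  assume "\<not> |Pow B| \<le>o |UNIV :: 'k set|"
  then have "|UNIV :: 'k set| \<le>o |Pow B|"
    by (simp add: not_ordLeq_iff_ordLess card_of_Well_order ordLess_imp_ordLeq)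
  then obtain s :: "'k \<Rightarrow> 'k set" where s: "inj s" "range s \<subseteq> Pow B"
    unfolding card_of_ordLeq[symmetric] by blast
  obtain U :: "'k filter" where U: "ultrafilter U" "nonprincipal U"
    "complete_filter |UNIV :: 'k set| U"
    using meas unfolding measurable_cardinal_def by blast
  define X where "X b = (if {k. b \<in> s k} \<in> members U then {k. b \<in> s k} else - {k. b \<in> s k})" for b
  have "X b \<in> members U" for b
    using U(1) unfolding ultrafilter_def X_def by auto
  moreover have "|X ` B| <o |UNIV :: 'k set|"
    by (rule ordLeq_ordLess_trans[OF card_of_image B])
  ultimately have mem: "\<Inter> (X ` B) \<in> members U"
    using U(3) unfolding complete_filter_def by (simp add: image_subset_iff)
  moreover have "{} \<notin> members U"
    using U(1) by (simp add: ultrafilter_def members_def trivial_limit_def)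
  ultimately have "\<Inter> (X ` B) \<noteq> {}" by metis
  then obtain k where k: "k \<in> \<Inter> (X ` B)" by blast
  have "k' = k" if k': "k' \<in> \<Inter> (X ` B)" for k'
  proof -
    have "b \<in> s k' \<longleftrightarrow> b \<in> s k" if "b \<in> B" for b
    proof -
      have "k \<in> X b" "k' \<in> X b" using k k' that by blast+
      then show ?thesis by (simp add: X_def split: if_splits)
    qed
    moreover have "s k' \<subseteq> B" "s k \<subseteq> B" using s(2) by auto
    ultimately have "s k' = s k" by blast
    then show ?thesis using s(1) by (simp add: inj_eq)
  qed
  with k have "\<Inter> (X ` B) = {k}" by blast
  with mem U(2) show False by (simp add: nonprincipal_def)
qed

lemma uniform_eventually_notin:
  fixes E :: "'k filter"
  assumes "ultrafilter E" "uniform E" "|B| <o |UNIV :: 'k set|"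
  shows "eventually (\<lambda>t. t \<notin> B) E"
proof -
  have "B \<notin> members E"
    using assms(2,3) not_ordLess_ordIso unfolding uniform_def by blast
  then have "- B \<in> members E"
    using assms(1) unfolding ultrafilter_def by blast
  then show ?thesis by (simp add: members_def)
qed

text \<open>
  Proper initial segments of a cardinal are smaller than it, hence null for a uniform ultrafilter.
\<close>

lemma uniform_eventually_above:
  fixes E :: "'k filter"
  assumes "ultrafilter E" "uniform E" "infinite (UNIV :: 'k set)"
  shows "eventually (\<lambda>t. i \<in> underS |UNIV :: 'k set| t) E"
proof -
  let ?r = "|UNIV :: 'k set|"
  have r: "Card_order ?r" "Field ?r = UNIV" "Well_order ?r"
    by (simp_all only: card_of_card_order_on card_of_well_order_on Field_card_of)
  have "|{i}| <o ?r"
    using assms(3)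
    by (intro finite_ordLess_infinite) (simp_all add: card_of_well_order_on Field_card_of)
  from uniform_eventually_notin[OF assms(1,2) this]
  have "eventually (\<lambda>t. t \<notin> {i}) E" .
  moreover have "|underS ?r i| <o ?r"
    using card_of_underS[OF r(1)] r(2) by blast
  from uniform_eventually_notin[OF assms(1,2) this]
  have "eventually (\<lambda>t. t \<notin> underS ?r i) E" .
  ultimately show ?thesis
  proof eventually_elim
    case (elim t)
    then show ?case
      using r(2,3) by (auto simp: underS_def order_on_defs total_on_def)
  qed
qed

text \<open>
  At \<open>t\<close>, the function attached to \<open>S\<close> codes the part of \<open>S\<close> below \<open>t\<close>; there are at most \<open>\<kappa>\<close> such
  parts because \<open>\<kappa>\<close> is a strong limit. Two sets that differ at \<open>i\<close> have different codes at all
  \<open>t > i\<close>.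
\<close>

lemma eventually_different_family:
  fixes E :: "'k filter"
  assumes "measurable_cardinal |UNIV :: 'k set|" "infinite (UNIV :: 'k set)"
    and "ultrafilter E" "uniform E"
  shows "\<exists>b :: 'k set \<Rightarrow> 'k \<Rightarrow> 'k. \<forall>S S'. S \<noteq> S' \<longrightarrow> eventually (\<lambda>t. b S t \<noteq> b S' t) E"
proof -
  let ?r = "|UNIV :: 'k set|"
  have "\<exists>c :: 'k set \<Rightarrow> 'k. inj_on c (Pow (underS ?r t))" for t
  proof -
    have "|underS ?r t| <o ?r"
      by (rule card_of_underS) (simp_all only: card_of_card_order_on Field_card_of UNIV_I)
    from measurable_strong_limit[OF assms(1) this] show ?thesis
      unfolding card_of_ordLeq[symmetric] by blast
  qed
  then obtain c :: "'k \<Rightarrow> 'k set \<Rightarrow> 'k" where c: "\<And>t. inj_on (c t) (Pow (underS ?r t))"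
    by metis
  show ?thesis
  proof (intro exI allI impI)
    fix S S' :: "'k set" assume "S \<noteq> S'"
    then obtain i where i: "i \<in> S \<longleftrightarrow> i \<notin> S'" by blast
    have "eventually (\<lambda>t. i \<in> underS ?r t) E"
      by (rule uniform_eventually_above[OF assms(3,4,2)])
    then show "eventually (\<lambda>t. c t (S \<inter> underS ?r t) \<noteq> c t (S' \<inter> underS ?r t)) E"
    proof eventually_elim
      case (elim t)
      then have "S \<inter> underS ?r t \<noteq> S' \<inter> underS ?r t" using i by blast
      then show ?case using inj_onD[OF c[of t]] by blast
    qed
  qed
qed

text \<open>
  At each \<open>s\<close> only finitely many regularizing sets are involved, so their indices can be given
  distinct values in \<open>A\<close> there. Two indices receive different values on the intersection of their
  sets.
\<close>

lemma regular_different_family: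
  fixes D :: "'l filter"
  assumes "regular_filter D" "infinite A"
  shows "\<exists>w :: 'l \<Rightarrow> 'l \<Rightarrow> 'a. (\<forall>i s. w i s \<in> A) \<and>
    (\<forall>i j. i \<noteq> j \<longrightarrow> eventually (\<lambda>s. w i s \<noteq> w j s) D)"
proof -
  obtain X :: "'l \<Rightarrow> 'l set" where X: "\<And>i. X i \<in> members D" "\<And>s. finite {i. s \<in> X i}"
    using assms(1) unfolding regular_filter_def by blast
  obtain m :: "nat \<Rightarrow> 'a" where m: "inj m" "range m \<subseteq> A"
    using assms(2) infinite_countable_subset by blast
  have "\<exists>q :: 'l \<Rightarrow> nat. inj_on q {i. s \<in> X i}" for s
    using finite_imp_inj_to_nat_seg[OF X(2)] by blast
  then obtain q :: "'l \<Rightarrow> 'l \<Rightarrow> nat" where q: "\<And>s. inj_on (q s) {i. s \<in> X i}"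
    by metis
  show ?thesis
  proof (intro exI conjI allI impI)
    show "m (q s i) \<in> A" for i s using m(2) by blast
    fix i j :: 'l assume "i \<noteq> j"
    have "eventually (\<lambda>s. s \<in> X i) D" "eventually (\<lambda>s. s \<in> X j) D"
      using X(1) by (auto simp: members_def)
    then show "eventually (\<lambda>s. m (q s i) \<noteq> m (q s j)) D"
    proof eventually_elim
      case (elim s)
      then show ?case using \<open>i \<noteq> j\<close> inj_onD[OF q[of s]] m(1) by (auto simp: inj_eq)
    qed
  qed
qed

text \<open>
  As \<open>\<kappa> \<times> \<kappa>\<close> injects into \<open>\<kappa>\<close>, functions from \<open>\<kappa>\<close> to its power set are as few as subsets of
  \<open>\<kappa>\<close>, and Cantor's theorem applies.
\<close>

lemma no_injection_Pow_Pow: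
  fixes G :: "'k set set \<Rightarrow> 'k \<Rightarrow> 'k set"
  assumes "infinite (UNIV :: 'k set)"
  shows "\<not> inj G"
proof
  assume G: "inj G"
  have "|UNIV :: ('k \<times> 'k) set| \<le>o |UNIV :: 'k set|"
    using card_of_Times_same_infinite[OF assms] by (simp add: ordIso_imp_ordLeq)
  then obtain p :: "'k \<times> 'k \<Rightarrow> 'k" where p: "inj p"
    unfolding card_of_ordLeq[symmetric] by blast
  have "inj (\<lambda>Y. p ` Sigma UNIV (G Y))"
  proof (rule injI)
    fix Y Z assume "p ` Sigma UNIV (G Y) = p ` Sigma UNIV (G Z)"
    then have *: "Sigma UNIV (G Y) = Sigma UNIV (G Z)"
      using p by (simp add: inj_image_eq_iff)
    have "G Y = G Z"
    proof
      fix t show "G Y t = G Z t"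
        using arg_cong[OF *, of "\<lambda>R. R `` {t}"] by auto
    qed
    with G show "Y = Z" by (simp add: inj_eq)
  qed
  then have "surj (inv (\<lambda>Y. p ` Sigma UNIV (G Y)))" by (rule inj_imp_surj_inv)
  then show False using Cantors_theorem[of "UNIV :: 'k set set"] by auto
qed

text \<open>
  Finitely many of the parameters are pairwise different almost everywhere, so the extension
  property of \<open>M\<close> provides a witness at almost every index.
\<close>

lemma separated_parameters_type:
  fixes D :: "'i filter" and a :: "'s \<Rightarrow> 'i \<Rightarrow> 'm"
  assumes M: "is_model M random_graph_theory" and D: "D \<noteq> bot"
    and a: "\<And>S i. a S i \<in> univ M"
    and diff: "\<And>S S'. S \<noteq> S' \<Longrightarrow> eventually (\<lambda>i. a S i \<noteq> a S' i) D"
  shows "is_type (ultrapower D M) (range (\<lambda>S. up_class D M (a S)))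
    (range (\<lambda>S. (if S \<in> Y then Rel 0 1 else Neg (Rel 0 1), \<lambda>_. up_class D M (a S))))"
    (is "is_type ?N ?A (range ?p)")
  unfolding is_type_def
proof (intro conjI allI impI)
  show "range ?p \<subseteq> formulas_over ?A"
    by (auto simp: formulas_over_def)
  fix q assume q: "q \<subseteq> range ?p \<and> finite q"
  then obtain T where T: "finite T" "q = ?p ` T"
    using finite_subset_image[of q ?p UNIV] by blast
  have "eventually (\<lambda>i. S \<noteq> S' \<longrightarrow> a S i \<noteq> a S' i) D" for S S'
    by (cases "S = S'") (simp_all add: diff)
  then have *: "eventually (\<lambda>i. \<forall>S \<in> T. \<forall>S' \<in> T. S \<noteq> S' \<longrightarrow> a S i \<noteq> a S' i) D"
    using T(1) by (intro eventually_ball_finite ballI)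
  define Q where "Q i z \<longleftrightarrow> z \<in> univ M \<and> (\<forall>S \<in> T. edge M z (a S i) \<longleftrightarrow> S \<in> Y)" for i z
  have ex: "eventually (\<lambda>i. \<exists>z. Q i z) D"
    using * unfolding Q_def
  proof eventually_elim
    case (elim i)
    have "(\<lambda>S. a S i) ` (T \<inter> Y) \<inter> (\<lambda>S. a S i) ` (T - Y) = {}"
    proof (rule equals0I)
      fix y assume "y \<in> (\<lambda>S. a S i) ` (T \<inter> Y) \<inter> (\<lambda>S. a S i) ` (T - Y)"
      then obtain S S' where "S \<in> T \<inter> Y" "S' \<in> T - Y" "a S i = a S' i" by auto
      with elim show False by (metis DiffE IntE)
    qed
    then have "\<exists>z \<in> univ M. (\<forall>u \<in> (\<lambda>S. a S i) ` (T \<inter> Y). edge M z u) \<and>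
        (\<forall>v \<in> (\<lambda>S. a S i) ` (T - Y). \<not> edge M z v)"
      by (intro extension_property[OF M]) (use T(1) a in auto)
    then obtain z where z: "z \<in> univ M" "\<And>S. S \<in> T \<inter> Y \<Longrightarrow> edge M z (a S i)"
      "\<And>S. S \<in> T - Y \<Longrightarrow> \<not> edge M z (a S i)"
      by auto
    have "edge M z (a S i) \<longleftrightarrow> S \<in> Y" if "S \<in> T" for S
      using z(2,3)[of S] that by auto
    with z(1) show ?case by blast
  qed
  obtain m where m: "m \<in> univ M"
    using M by (auto simp: is_model_def)
  define x where "x i = (if \<exists>z. Q i z then SOME z. Q i z else m)" for i
  have x_Q: "Q i (x i)" if "\<exists>z. Q i z" for i
    using someI_ex[OF that] that by (simp add: x_def)
  have x_in: "x i \<in> univ M" for i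
  proof (cases "\<exists>z. Q i z")
    case True
    then show ?thesis using x_Q by (simp add: Q_def)
  qed (simp add: x_def m)
  have "eventually (\<lambda>i. Q i (x i)) D"
    using ex by eventually_elim (rule x_Q)
  then have ev: "eventually (\<lambda>i. \<forall>S \<in> T. edge M (x i) (a S i) \<longleftrightarrow> S \<in> Y) D"
    by eventually_elim (simp add: Q_def)
  have x: "range x \<subseteq> univ M" "range (a S) \<subseteq> univ M" for S
    using x_in a by auto
  have edge_iff: "edge ?N (up_class D M x) (up_class D M (a S)) \<longleftrightarrow> S \<in> Y" if "S \<in> T" for S
  proof -
    have "eventually (\<lambda>i. edge M (x i) (a S i) \<longleftrightarrow> S \<in> Y) D"
      using ev by eventually_elim (use that in blast)
    then have "eventually (\<lambda>i. edge M (x i) (a S i)) D \<longleftrightarrow> eventually (\<lambda>i. S \<in> Y) D"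
      by (rule eventually_cong)
    then show ?thesis
      using D by (simp add: edge_ultrapower[OF x(1) x(2)])
  qed
  then have "realizes ?N (up_class D M x) q"
    unfolding realizes_def T(2) by simp
  moreover have "up_class D M x \<in> univ ?N"
    using x(1) by (simp add: univ_ultrapower)
  ultimately show "\<exists>a \<in> univ ?N. realizes ?N a q" by blast
qed

text \<open>
  If every type ``adjacent to exactly the parameters in \<open>Y\<close>'' were realized, sending \<open>Y\<close> to the
  trace of a realization would be an injection that \<open>no_injection_Pow_Pow\<close> excludes.
\<close>

lemma product_not_saturated:
  fixes D1 :: "'l filter" and E :: "'k filter" and M :: "'m struct"
  assumes M: "is_model M random_graph_theory"
    and meas: "measurable_cardinal |UNIV :: 'k set|" and inf: "infinite (UNIV :: 'k set)"
    and E: "ultrafilter E" "uniform E"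
    and D1: "ultrafilter D1" "regular_filter D1"
    and le: "|UNIV :: 'k set| \<le>o |UNIV :: 'l set|"
  shows "\<not> saturated (cardSuc (ctwo ^c |UNIV :: 'k set| ))
    (ultrapower (product_ultrafilter D1 E) M)"
proof
  let ?D = "product_ultrafilter D1 E"
  let ?N = "ultrapower ?D M"
  assume sat: "saturated (cardSuc (ctwo ^c |UNIV :: 'k set| )) ?N"
  obtain b :: "'k set \<Rightarrow> 'k \<Rightarrow> 'k"
    where b: "\<And>S S'. S \<noteq> S' \<Longrightarrow> eventually (\<lambda>t. b S t \<noteq> b S' t) E"
    using eventually_different_family[OF meas inf E] by blast
  obtain w :: "'l \<Rightarrow> 'l \<Rightarrow> 'm" where w: "\<And>i s. w i s \<in> univ M"
    "\<And>i j. i \<noteq> j \<Longrightarrow> eventually (\<lambda>s. w i s \<noteq> w j s) D1"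
    using regular_different_family[OF D1(2) random_graph_model_infinite[OF M]] by blast
  obtain \<iota> :: "'k \<Rightarrow> 'l" where \<iota>: "inj \<iota>"
    using le unfolding card_of_ordLeq[symmetric] by blast
  \<comment> \<open>Column \<open>t\<close> of the parameter \<open>a S\<close> is the point number \<open>b S t\<close> of \<open>M\<^sup>\<lambda>/D1\<close>.\<close>
  define a where "a S = (\<lambda>(s, t). w (\<iota> (b S t)) s)" for S
  have a: "a S x \<in> univ M" for S x
    using w(1) by (simp add: a_def split: prod.split)
  have a_diff: "eventually (\<lambda>x. a S x \<noteq> a S' x) ?D" if "S \<noteq> S'" for S S'
    unfolding eventually_product_ultrafilter
    using b[OF that] by eventually_elim (use w(2) \<iota> in \<open>simp add: a_def inj_eq\<close>)
  let ?A = "range (\<lambda>S. up_class ?D M (a S))"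
  let ?p = "\<lambda>Y. range (\<lambda>S. (if S \<in> Y then Rel 0 1 else Neg (Rel 0 1), \<lambda>_ :: nat. up_class ?D M (a S)))"
  have "|?A| <o cardSuc (ctwo ^c |UNIV :: 'k set| )"
  proof -
    have "|?A| \<le>o |UNIV :: 'k set set|" by (rule card_of_image)
    also have "|UNIV :: 'k set set| =o ctwo ^c |UNIV :: 'k set|"
      using card_of_Pow_Func[of "UNIV :: 'k set"] by (simp add: cexp_def ctwo_def Field_card_of)
    finally show ?thesis
      by (rule iffD2[OF cardSuc_ordLeq_ordLess[OF Card_order_cexp card_of_Card_order]])
  qed
  moreover have "?A \<subseteq> univ ?N"
    using a by (auto simp: univ_ultrapower)
  moreover have "?D \<noteq> bot"
    using ultrafilter_product[OF D1(1) E(1)] by (simp add: ultrafilter_def)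
  then have "is_type ?N ?A (?p Y)" for Y
    by (rule separated_parameters_type[OF M _ a a_diff])
  ultimately have "\<exists>z \<in> univ ?N. realizes ?N z (?p Y)" for Y
    using sat unfolding saturated_def by blast
  then have "\<exists>x. range x \<subseteq> univ M \<and> realizes ?N (up_class ?D M x) (?p Y)" for Y
    unfolding univ_ultrapower by blast
  then have "\<forall>Y. \<exists>x. range x \<subseteq> univ M \<and> realizes ?N (up_class ?D M x) (?p Y)" ..
  from choice[OF this] obtain x
    where x_choice: "\<forall>Y. range (x Y) \<subseteq> univ M \<and> realizes ?N (up_class ?D M (x Y)) (?p Y)" ..
  have x: "range (x Y) \<subseteq> univ M" for Y
    using x_choice[rule_format, of Y] by (rule conjunct1)
  have x_real: "realizes ?N (up_class ?D M (x Y)) (?p Y)" for Y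
    using x_choice[rule_format, of Y] by (rule conjunct2)
  have x_edge: "S \<in> Y \<longleftrightarrow> eventually (\<lambda>i. edge M (x Y i) (a S i)) ?D" for Y S
  proof -
    have "sat ?N ((\<lambda>_. up_class ?D M (a S))(0 := up_class ?D M (x Y)))
        (if S \<in> Y then Rel 0 1 else Neg (Rel 0 1))"
      using bspec[OF x_real[of Y, unfolded realizes_def] rangeI[of _ S]] by (simp only: prod.case)
    then have "edge ?N (up_class ?D M (x Y)) (up_class ?D M (a S)) \<longleftrightarrow> S \<in> Y"
      by (cases "S \<in> Y") simp_all
    moreover have "range (a S) \<subseteq> univ M" using a by auto
    ultimately show ?thesis by (simp add: edge_ultrapower[OF x])
  qed
  \<comment> \<open>The trace of a realization \<open>x Y\<close>: the points of \<open>M\<^sup>\<lambda>/D1\<close> adjacent to its column \<open>t\<close>. It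
    determines \<open>Y\<close>, because the columns of the parameters are such points.\<close>
  define G where "G Y t = {i. eventually (\<lambda>s. edge M (x Y (s, t)) (w (\<iota> i) s)) D1}" for Y t
  have "S \<in> Y \<longleftrightarrow> eventually (\<lambda>t. b S t \<in> G Y t) E" for S Y
    unfolding x_edge[of S Y] by (simp add: eventually_product_ultrafilter a_def G_def)
  then have "inj G"
    by (intro injI set_eqI) simp
  then show False using no_injection_Pow_Pow[OF inf] by blast
qed

theorem corollary6p5:
  fixes E :: "'k filter" and D1 :: "'l filter" and D :: "('l \<times> 'k) filter"
  assumes "natLeq <o |UNIV :: 'k set|"
    and "|UNIV :: 'k set| <o |UNIV :: 'l set|"
    and "|UNIV :: 'l set| =o |UNIV :: 'l set| ^c |UNIV :: 'k set|"
    and "ctwo ^c |UNIV :: 'k set| \<le>o |UNIV :: 'l set|"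
    and "measurable_cardinal |UNIV :: 'k set|"
    and "ultrafilter E" and "uniform E" and "complete_filter (cardSuc natLeq) E"
    and "ultrafilter D1" and "regular_filter D1" and "succ_good (UNIV :: 'l set) D1"
    and "D = product_ultrafilter D1 E"
  shows "lcf D =o lcf D1 \<and> cardSuc |UNIV :: 'l set| \<le>o lcf D1 \<and>
    |UNIV :: ('l \<times> 'k) set| =o |UNIV :: 'l set| \<and>
    ultrafilter D \<and> regular_filter D \<and>
    (\<forall>M :: 'm struct. is_model M random_graph_theory \<longrightarrow>
       \<not> saturated (cardSuc (ctwo ^c |UNIV :: 'k set| )) (ultrapower D M))"
proof -
  have infk: "infinite (UNIV :: 'k set)"
    using infinite_iff_natLeq_ordLeq[of "UNIV :: 'k set"] ordLess_imp_ordLeq[OF assms(1)] by simp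
  have le: "|UNIV :: 'k set| \<le>o |UNIV :: 'l set|"
    using assms(2) by (rule ordLess_imp_ordLeq)
  have infl: "infinite (UNIV :: 'l set)"
    using card_of_ordLeq_infinite[OF le infk] .
  have times: "|UNIV :: ('l \<times> 'k) set| =o |UNIV :: 'l set|"
    using card_of_Times_infinite[OF infl _ le] by simp
  have bot: "E \<noteq> bot" "D1 \<noteq> bot"
    using assms(6,9) by (auto simp: ultrafilter_def)
  show ?thesis
    unfolding assms(12)
  proof (intro conjI allI impI)
    show "lcf (product_ultrafilter D1 E) =o lcf D1"
      by (rule lcf_product[OF assms(11,10) infl le assms(8) bot(1)])
    show "cardSuc |UNIV :: 'l set| \<le>o lcf D1"
      by (rule lcf_good_regular[OF assms(11,10) infl bot(2)])
    show "|UNIV :: ('l \<times> 'k) set| =o |UNIV :: 'l set|"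
      by (rule times)
    show "ultrafilter (product_ultrafilter D1 E)"
      by (rule ultrafilter_product[OF assms(9,6)])
    show "regular_filter (product_ultrafilter D1 E)"
      by (rule regular_filter_product[OF assms(10) ordIso_imp_ordLeq[OF times]])
    fix M :: "'m struct" assume M: "is_model M random_graph_theory"
    show "\<not> saturated (cardSuc (ctwo ^c |UNIV :: 'k set| ))
        (ultrapower (product_ultrafilter D1 E) M)"
      by (rule product_not_saturated[OF M assms(5) infk assms(6,7,9,10) le])
  qed
qed

end
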